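(* Let $p\ge 3$ be a prime, let $k$ be a positive integer, let $G$ be the set of monic polynomials of degree at most $2$ in $\mathbb{F}_p[X]$, let $U_G$ be a random variable uniformly distributed in $G$, and let $A:=P_k(U_G)$. Let $U_k$ be uniformly distributed on $\{0,1\}^k$. Then $$\Delta(A,U_k)\ll\sqrt{\frac{2^{k}}{p}}\left(1+\frac{\sqrt{\log_2(p)}}{p+1}\right),$$ where the implied constant is absolute.
   Context: Statistical distance: for random variables $X,Y$ with values in a finite set $\mathcal{X}$, $\Delta(X,Y)=\frac12\sum_{x\in\mathcal{X}}|\Pr[X=x]-\Pr[Y=x]|$. For $x\in\mathbb{F}_p$, identified with its representative in $\{0,1,\dots,p-1\}$, $\mathrm{lsb}_k(x)\in\{0,1\}^k$ denotes the $k$ least significant bits of $x$. The elements of $G$ are the possible first components $u$ of Mumford representations $[u,v]$ of reduced divisors on a genus $2$ hyperelliptic curve over $\mathbb{F}_p$. The extractor $P_k:G\to\{0,1\}^k$ depends only on this first component and is defined by $P_k(X^2+u_1X+u_0)=\mathrm{lsb}_k(u_0)$, $P_k(X+u_0)=\mathrm{lsb}_k(-u_0)$, and $P_k(1)=0$ (the zero string). *)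

theory Defs
  imports "HOL-Probability.Probability" "HOL-Number_Theory.Residues" "HOL-Algebra.UnivPoly"
begin

(* Random variables on finite sets are represented by their laws, as values of type pmf. *)
definition stat_dist :: "'a set \<Rightarrow> 'a pmf \<Rightarrow> 'a pmf \<Rightarrow> real" where
  "stat_dist S X Y = (1 / 2) * (\<Sum>x\<in>S. \<bar>pmf X x - pmf Y x\<bar>)"

definition bitstrings :: "nat \<Rightarrow> bool list set" where
  "bitstrings k = {bs. length bs = k}"

(* The list starts with the least significant bit. *)
definition lsb :: "nat \<Rightarrow> int \<Rightarrow> bool list" where
  "lsb k x = map (bit x) [0..<k]"

(* The carrier of this ring is {0..p - 1}, so an element of F_p is its own representative.
   The prime is a value and not a type so that an absolute constant can be chosen before it. *)
abbreviation Fp :: "nat \<Rightarrow> int ring" where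
  "Fp p \<equiv> residue_ring (int p)"

abbreviation FpX :: "nat \<Rightarrow> (int, nat \<Rightarrow> int) up_ring" where
  "FpX p \<equiv> UP (Fp p)"

(* The zero polynomial has deg 0 and leading coefficient 0, hence is not monic. *)
definition monic :: "nat \<Rightarrow> (nat \<Rightarrow> int) \<Rightarrow> bool" where
  "monic p u \<longleftrightarrow> up_ring.coeff (FpX p) u (deg (Fp p) u) = \<one>\<^bsub>Fp p\<^esub>"

definition monic_deg_le2 :: "nat \<Rightarrow> (nat \<Rightarrow> int) set" where
  "monic_deg_le2 p = {u \<in> carrier (FpX p). monic p u \<and> deg (Fp p) u \<le> 2}"

(* On a monic u, deg u = 2, 1, 0 are the cases X^2 + u1 X + u0, X + u0 and 1;
   the negation of u0 is taken in F_p before passing to the representative. *)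
definition extractor :: "nat \<Rightarrow> nat \<Rightarrow> (nat \<Rightarrow> int) \<Rightarrow> bool list" where
  "extractor p k u =
    (let u0 = up_ring.coeff (FpX p) u 0 in
     if deg (Fp p) u = 2 then lsb k u0
     else if deg (Fp p) u = 1 then lsb k (\<ominus>\<^bsub>Fp p\<^esub> u0)
     else replicate k False)"

context
  fixes p :: nat
  assumes p: "prime p"
begin

lemma cring_Fp: "cring (Fp p)"
proof -
  interpret residues "int p" "Fp p"
    using p prime_gt_1_nat by unfold_locales auto
  show ?thesis by (rule cring)
qed

interpretation UP_cring "Fp p" "FpX p"
  by (simp_all add: UP_cring_def cring_Fp)

lemma Fp_one_neq_zero: "\<one>\<^bsub>Fp p\<^esub> \<noteq> \<zero>\<^bsub>Fp p\<^esub>"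
  by (simp add: residue_ring_def)

lemma deg_quadratic:
  assumes "u1 \<in> carrier (Fp p)" "u0 \<in> carrier (Fp p)"
  shows "deg (Fp p) (monom (FpX p) \<one>\<^bsub>Fp p\<^esub> 2 \<oplus>\<^bsub>FpX p\<^esub> monom (FpX p) u1 1 \<oplus>\<^bsub>FpX p\<^esub> monom (FpX p) u0 0) = 2"
  using assms Fp_one_neq_zero by (intro le_antisym deg_aboveI deg_belowI) auto

lemma deg_linear:
  assumes "u0 \<in> carrier (Fp p)"
  shows "deg (Fp p) (monom (FpX p) \<one>\<^bsub>Fp p\<^esub> 1 \<oplus>\<^bsub>FpX p\<^esub> monom (FpX p) u0 0) = 1"
  using assms Fp_one_neq_zero by (intro le_antisym deg_aboveI deg_belowI) auto

lemma monic_deg_le2_eq: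
  "monic_deg_le2 p =
    {monom (FpX p) \<one>\<^bsub>Fp p\<^esub> 2 \<oplus>\<^bsub>FpX p\<^esub> monom (FpX p) u1 1 \<oplus>\<^bsub>FpX p\<^esub> monom (FpX p) u0 0
      | u1 u0. u1 \<in> carrier (Fp p) \<and> u0 \<in> carrier (Fp p)}
    \<union> {monom (FpX p) \<one>\<^bsub>Fp p\<^esub> 1 \<oplus>\<^bsub>FpX p\<^esub> monom (FpX p) u0 0 | u0. u0 \<in> carrier (Fp p)}
    \<union> {\<one>\<^bsub>FpX p\<^esub>}"
  (is "?L = ?R")
proof
  show "?R \<subseteq> ?L"
    by (auto simp: monic_deg_le2_def monic_def deg_quadratic deg_linear simp del: One_nat_def)
  show "?L \<subseteq> ?R"
  proof
    fix u assume "u \<in> ?L"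
    then have u: "u \<in> carrier (FpX p)" and lc: "up_ring.coeff (FpX p) u (deg (Fp p) u) = \<one>\<^bsub>Fp p\<^esub>"
      and d: "deg (Fp p) u \<le> 2"
      by (auto simp: monic_deg_le2_def monic_def)
    let ?c = "up_ring.coeff (FpX p) u"
    from d consider "deg (Fp p) u = 2" | "deg (Fp p) u = 1" | "deg (Fp p) u = 0" by linarith
    then show "u \<in> ?R"
    proof cases
      case 1
      have "u = monom (FpX p) \<one>\<^bsub>Fp p\<^esub> 2 \<oplus>\<^bsub>FpX p\<^esub> monom (FpX p) (?c 1) 1 \<oplus>\<^bsub>FpX p\<^esub> monom (FpX p) (?c 0) 0"
      proof (rule up_eqI)
        fix n :: nat
        consider "n = 0" | "n = 1" | "n = 2" | "n > 2" by linarith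
        then show "?c n = up_ring.coeff (FpX p) (monom (FpX p) \<one>\<^bsub>Fp p\<^esub> 2
          \<oplus>\<^bsub>FpX p\<^esub> monom (FpX p) (?c 1) 1 \<oplus>\<^bsub>FpX p\<^esub> monom (FpX p) (?c 0) 0) n"
          using 1 u lc by cases (auto simp: deg_aboveD)
      qed (use u in auto)
      then show ?thesis using u by (blast intro: coeff_closed)
    next
      case 2
      have "u = monom (FpX p) \<one>\<^bsub>Fp p\<^esub> 1 \<oplus>\<^bsub>FpX p\<^esub> monom (FpX p) (?c 0) 0"
      proof (rule up_eqI)
        fix n :: nat
        consider "n = 0" | "n = 1" | "n > 1" by linarith
        then show "?c n = up_ring.coeff (FpX p) (monom (FpX p) \<one>\<^bsub>Fp p\<^esub> 1
          \<oplus>\<^bsub>FpX p\<^esub> monom (FpX p) (?c 0) 0) n"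
          using 2 u lc by cases (auto simp: deg_aboveD)
      qed (use u in auto)
      then show ?thesis using u by (blast intro: coeff_closed)
    next
      case 3
      have "u = \<one>\<^bsub>FpX p\<^esub>"
      proof (rule up_eqI)
        fix n :: nat
        show "?c n = up_ring.coeff (FpX p) \<one>\<^bsub>FpX p\<^esub> n"
          using 3 u lc by (cases "n = 0") (auto simp: deg_aboveD)
      qed (use u in auto)
      then show ?thesis by blast
    qed
  qed
qed

lemma finite_monic_deg_le2: "finite (monic_deg_le2 p)"
proof -
  have "finite (carrier (Fp p))" by (simp add: residue_ring_def)
  then show ?thesis by (simp add: monic_deg_le2_eq finite_image_set2)
qed

lemma monic_deg_le2_nonempty: "monic_deg_le2 p \<noteq> {}"
  by (simp add: monic_deg_le2_eq)

lemma extractor_quadratic: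
  assumes "u1 \<in> carrier (Fp p)" "u0 \<in> carrier (Fp p)"
  shows "extractor p k (monom (FpX p) \<one>\<^bsub>Fp p\<^esub> 2 \<oplus>\<^bsub>FpX p\<^esub> monom (FpX p) u1 1 \<oplus>\<^bsub>FpX p\<^esub> monom (FpX p) u0 0)
    = lsb k u0"
  using assms deg_quadratic[OF assms] by (simp add: extractor_def Let_def)

lemma extractor_linear:
  assumes "u0 \<in> carrier (Fp p)"
  shows "extractor p k (monom (FpX p) \<one>\<^bsub>Fp p\<^esub> 1 \<oplus>\<^bsub>FpX p\<^esub> monom (FpX p) u0 0)
    = lsb k ((- u0) mod int p)"
proof -
  interpret residues "int p" "Fp p"
    using p prime_gt_1_nat by unfold_locales auto
  show ?thesis
    using assms deg_linear[OF assms] by (simp add: extractor_def Let_def res_neg_eq)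
qed

lemma extractor_one: "extractor p k \<one>\<^bsub>FpX p\<^esub> = replicate k False"
  by (simp add: extractor_def Let_def)

end

lemma finite_bitstrings: "finite (bitstrings k)"
  using finite_lists_length_eq[of "UNIV :: bool set" k] by (simp add: bitstrings_def)

lemma bitstrings_nonempty: "bitstrings k \<noteq> {}"
  by (auto simp: bitstrings_def intro: exI[of _ "replicate k False"])

end

theory Submission
  imports Defs
begin

text \<open>For \<open>2^k \<ge> p\<close> the bound is trivial, as a statistical distance is at most \<open>1\<close>. Otherwise let
  \<open>c\<close> be the number of elements of \<open>{0..p - 1}\<close> whose \<open>k\<close> lowest bits form a given string.
  Since negation permutes the field, that string is extracted from \<open>(p + 1) c\<close> polynomials, or from
  one more if it is the zero string. Equidistribution of residues modulo \<open>2^k\<close> gives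
  \<open>|c - p / 2^k| \<le> 1\<close>, and dividing by \<open>|G| = p^2 + p + 1\<close> and summing over all strings bounds the
  distance by \<open>2^k / p \<le> sqrt (2^k / p)\<close>.\<close>

text \<open>Nonnegative \<open>a\<close>, \<open>b\<close> satisfy
  \<open>|a - b| \<le> a + b\<close>, and each law puts mass at most \<open>1\<close> on
  \<open>S\<close>.\<close>

lemma stat_dist_le_1:
  assumes "finite S"
  shows "stat_dist S X Y \<le> 1"
proof -
  have "(\<Sum>x\<in>S. \<bar>pmf X x - pmf Y x\<bar>) \<le> (\<Sum>x\<in>S. pmf X x + pmf Y x)"
    by (intro sum_mono) (simp add: abs_le_iff add_increasing)
  also have "\<dots> = measure_pmf.prob X S + measure_pmf.prob Y S"
    using assms by (simp add: sum.distrib measure_measure_pmf_finite)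
  also have "\<dots> \<le> 1 + 1"
    by (intro add_mono measure_pmf.prob_le_1)
  finally show ?thesis by (simp add: stat_dist_def)
qed

text \<open>With \<open>s = r mod m\<close>, the class meets \<open>{0..<n}\<close> in the
  progression \<open>s, s + m, ...\<close>, whose length is \<open>n / m\<close> up to an error of
  at most \<open>1\<close> because \<open>0 \<le> s < m\<close>.\<close>

lemma card_residue_class_bound:
  fixes m n r :: int
  assumes "0 < m" "0 \<le> n"
  shows "\<bar>real (card {z \<in> {0..<n}. z mod m = r mod m}) - n / m\<bar> \<le> 1"
proof -
  define s where "s = r mod m"
  have s: "0 \<le> s" "s < m" using assms by (simp_all add: s_def)
  \<comment> \<open>The ceiling of \<open>(n - s) / m\<close>: the number of
    \<open>j \<ge> 0\<close> with \<open>s + j * m < n\<close>. It is \<open>0\<close> when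
    \<open>s \<ge> n\<close>.\<close>
  define q where "q = (n - s + m - 1) div m"
  have q0: "0 \<le> q" using s assms by (simp add: q_def pos_imp_zdiv_nonneg_iff)
  have "m * q + (n - s + m - 1) mod m = n - s + m - 1"
    unfolding q_def by (rule mult_div_mod_eq)
  moreover have "0 \<le> (n - s + m - 1) mod m" "(n - s + m - 1) mod m < m"
    using assms by simp_all
  ultimately have q_le: "m * q \<le> n - s + m - 1" and q_gt: "n - s + m - 1 < m * q + m"
    by linarith+
  have "{z \<in> {0..<n}. z mod m = s} = (\<lambda>j. s + j * m) ` {0..<q}" (is "?L = ?R")
  proof (intro equalityI subsetI)
    fix z assume z: "z \<in> ?L"
    then have eq: "z = s + (z div m) * m" using div_mult_mod_eq[of z m] by simp
    have "m * (z div m) < m * q"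
      using q_gt z eq by (auto simp: mult.commute)
    then have "z div m < q" using assms by simp
    moreover have "0 \<le> z div m" using z assms by (simp add: pos_imp_zdiv_nonneg_iff)
    ultimately show "z \<in> ?R" using eq by auto
  next
    fix z assume "z \<in> ?R"
    then obtain j where j: "z = s + j * m" "0 \<le> j" "j < q" unfolding image_def by fastforce
    have "m * (j + 1) \<le> m * q" using j assms by simp
    then have "z < n" using j q_le by (simp add: algebra_simps)
    then show "z \<in> ?L" using j s assms by simp
  qed
  moreover have "inj_on (\<lambda>j. s + j * m) {0..<q}"
    using assms by (auto intro: inj_onI)
  ultimately have "card {z \<in> {0..<n}. z mod m = s} = nat q"
    by (simp add: card_image)
  then have card: "real (card {z \<in> {0..<n}. z mod m = r mod m}) = q"
    using q0 by (simp add: s_def)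
  have "real_of_int (m * q) \<le> real_of_int (n + m)" "real_of_int n \<le> real_of_int (m * q + m)"
    using q_le q_gt s by linarith+
  then show ?thesis
    unfolding card using assms by (simp add: abs_le_iff field_simps)
qed

text \<open>Truncation to \<open>k\<close> bits keeps exactly the bits listed by \<open>lsb\<close>
  and clears the others, and it is reduction modulo \<open>2 ^ k\<close>. Fibres of
  \<open>lsb k\<close> are thus residue classes.\<close>

lemma lsb_eq_iff: "lsb k x = lsb k y \<longleftrightarrow> x mod 2 ^ k = y mod 2 ^ k"
proof -
  have "lsb k x = lsb k y \<longleftrightarrow> take_bit k x = take_bit k y"
    by (simp add: lsb_def bit_eq_iff[of "take_bit k x"] bit_take_bit_iff Ball_def) blast
  then show ?thesis by (simp add: take_bit_eq_mod)
qed

lemma bitstring_is_lsb: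
  assumes "s \<in> bitstrings k"
  obtains t where "s = lsb k t"
proof
  \<comment> \<open>The witness is the number with binary digits \<open>s\<close>, least significant
    first.\<close>
  show "s = lsb k (horner_sum of_bool 2 s)"
    using assms by (intro nth_equalityI) (simp_all add: lsb_def bitstrings_def bit_horner_sum_bit_iff)
qed

lemma card_lsb_fibre_bound:
  assumes "s \<in> bitstrings k"
  shows "\<bar>real (card {z \<in> {0..<int p}. lsb k z = s}) - p / 2 ^ k\<bar> \<le> 1"
proof -
  obtain t where t: "s = lsb k t" using assms by (rule bitstring_is_lsb)
  have "real_of_int (2 ^ k) = 2 ^ k" "real_of_int (int p) = real p" by simp_all
  moreover have "(0::int) < 2 ^ k" "0 \<le> int p" by simp_all
  note card_residue_class_bound[OF this, of t]
  ultimately show ?thesis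
    unfolding t lsb_eq_iff by (simp only:)
qed

lemma card_bitstrings: "card (bitstrings k) = 2 ^ k"
  using card_lists_length_eq[of "UNIV :: bool set" k] by (simp add: bitstrings_def)

lemma carrier_Fp: "carrier (Fp p) = {0..<int p}"
  by (auto simp: residue_ring_def)

text \<open>Negation modulo \<open>p\<close> is an involution of \<open>{0..<int p}\<close>. This
  absorbs the sign that the extractor puts on linear polynomials.\<close>

lemma card_negation_preimage:
  assumes "p > 0"
  shows "card {z \<in> {0..<int p}. P ((- z) mod int p)} = card {z \<in> {0..<int p}. P z}"
proof (rule bij_betw_same_card)
  have [simp]: "(- ((- z) mod int p)) mod int p = z" if "0 \<le> z" "z < int p" for z
    using that by (simp add: mod_minus_eq)
  show "bij_betw (\<lambda>z. (- z) mod int p)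
    {z \<in> {0..<int p}. P ((- z) mod int p)} {z \<in> {0..<int p}. P z}"
    by (rule bij_betw_byWitness[where f' = "\<lambda>z. (- z) mod int p"]) (use assms in auto)
qed

abbreviation quadratic :: "nat \<Rightarrow> int \<Rightarrow> int \<Rightarrow> nat \<Rightarrow> int" where
  "quadratic p u1 u0 \<equiv> monom (FpX p) \<one>\<^bsub>Fp p\<^esub> 2 \<oplus>\<^bsub>FpX p\<^esub> monom (FpX p) u1 1 \<oplus>\<^bsub>FpX p\<^esub> monom (FpX p) u0 0"

abbreviation linear_poly :: "nat \<Rightarrow> int \<Rightarrow> nat \<Rightarrow> int" where
  "linear_poly p u0 \<equiv> monom (FpX p) \<one>\<^bsub>Fp p\<^esub> 1 \<oplus>\<^bsub>FpX p\<^esub> monom (FpX p) u0 0"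

context
  fixes p :: nat
  assumes p: "prime p"
begin

interpretation UP_cring "Fp p" "FpX p"
  by (simp_all add: UP_cring_def cring_Fp p)

text \<open>The three families are disjoint by degree, and within a family the coefficients
  determine the polynomial. Used both for the size of the whole set and for the fibres of the
  extractor.\<close>

lemma card_monic_deg_le2_filter:
  "card {u \<in> monic_deg_le2 p. P u} =
    card {(u1, u0). u1 \<in> carrier (Fp p) \<and> u0 \<in> carrier (Fp p) \<and> P (quadratic p u1 u0)}
    + card {u0 \<in> carrier (Fp p). P (linear_poly p u0)} + of_bool (P \<one>\<^bsub>FpX p\<^esub>)"
proof -
  let ?Q = "{(u1, u0). u1 \<in> carrier (Fp p) \<and> u0 \<in> carrier (Fp p) \<and> P (quadratic p u1 u0)}"
  let ?L = "{u0 \<in> carrier (Fp p). P (linear_poly p u0)}"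
  let ?q = "\<lambda>(u1, u0). quadratic p u1 u0"
  let ?one = "if P \<one>\<^bsub>FpX p\<^esub> then {\<one>\<^bsub>FpX p\<^esub>} else {}"
  define A where "A = ?q ` ?Q"
  define B where "B = linear_poly p ` ?L"
  have fin: "finite (carrier (Fp p))" by (simp add: carrier_Fp)
  have "finite ?Q"
    by (rule finite_subset[of _ "carrier (Fp p) \<times> carrier (Fp p)"]) (use fin in auto)
  moreover have "finite ?L" using fin by simp
  ultimately have finite: "finite A" "finite B" by (simp_all add: A_def B_def del: One_nat_def)
  have partition: "{u \<in> monic_deg_le2 p. P u} = A \<union> B \<union> ?one"
    unfolding monic_deg_le2_eq[OF p] A_def B_def by (auto simp del: One_nat_def)
  have degA: "deg (Fp p) u = 2" if "u \<in> A" for u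
    using that by (auto simp: A_def deg_quadratic[OF p] simp del: One_nat_def)
  have degB: "deg (Fp p) u = 1" if "u \<in> B" for u
    using that by (auto simp: B_def deg_linear[OF p] simp del: One_nat_def)
  have "A \<inter> B = {}"
    using degA degB by (metis disjoint_iff numeral_eq_one_iff semiring_norm(85))
  moreover have "(A \<union> B) \<inter> ?one = {}"
    using degA[of "\<one>\<^bsub>FpX p\<^esub>"] degB[of "\<one>\<^bsub>FpX p\<^esub>"] by auto
  ultimately have "card {u \<in> monic_deg_le2 p. P u} = card A + card B + of_bool (P \<one>\<^bsub>FpX p\<^esub>)"
    using finite by (simp add: partition card_Un_disjoint)
  moreover have "inj_on ?q ?Q"
  proof (rule inj_onI, clarify)
    fix a b c d
    assume mem: "a \<in> carrier (Fp p)" "b \<in> carrier (Fp p)" "c \<in> carrier (Fp p)" "d \<in> carrier (Fp p)"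
      and eq: "quadratic p a b = quadratic p c d"
    show "a = c \<and> b = d"
      using mem arg_cong[OF eq, of "\<lambda>u. up_ring.coeff (FpX p) u 1"]
        arg_cong[OF eq, of "\<lambda>u. up_ring.coeff (FpX p) u 0"] by simp
  qed
  moreover have "inj_on (linear_poly p) ?L"
  proof (rule inj_onI, clarify)
    fix b d
    assume mem: "b \<in> carrier (Fp p)" "d \<in> carrier (Fp p)"
      and eq: "linear_poly p b = linear_poly p d"
    show "b = d"
      using mem arg_cong[OF eq, of "\<lambda>u. up_ring.coeff (FpX p) u 0"] by simp
  qed
  ultimately show ?thesis
    unfolding A_def B_def by (simp only: card_image)
qed

lemma card_monic_deg_le2: "card (monic_deg_le2 p) = p\<^sup>2 + p + 1"
proof -
  have "{(u1, u0). u1 \<in> carrier (Fp p) \<and> u0 \<in> carrier (Fp p)} = carrier (Fp p) \<times> carrier (Fp p)"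
    by auto
  moreover have "{u0. 0 \<le> u0 \<and> u0 < int p} = {0..<int p}" by auto
  ultimately show ?thesis
    using card_monic_deg_le2_filter[of "\<lambda>_. True"]
    by (simp add: carrier_Fp card_cartesian_product power2_eq_square)
qed

text \<open>Quadratics contribute \<open>p\<close> times the count, as \<open>u1\<close> is free;
  linear polynomials contribute it once, after a negation; the constant \<open>1\<close> falls into
  the fibre of the zero string.\<close>

lemma card_extractor_fibre:
  "card {u \<in> monic_deg_le2 p. extractor p k u = s} =
    (p + 1) * card {z \<in> {0..<int p}. lsb k z = s} + of_bool (replicate k False = s)"
proof -
  have "{(u1, u0). u1 \<in> carrier (Fp p) \<and> u0 \<in> carrier (Fp p) \<and> extractor p k (quadratic p u1 u0) = s}
    = {0..<int p} \<times> {z \<in> {0..<int p}. lsb k z = s}"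
    by (auto simp: extractor_quadratic[OF p] simp flip: carrier_Fp simp del: One_nat_def)
  moreover have "{u0 \<in> carrier (Fp p). extractor p k (linear_poly p u0) = s}
    = {z \<in> {0..<int p}. lsb k ((- z) mod int p) = s}"
    by (auto simp: extractor_linear[OF p] simp flip: carrier_Fp simp del: One_nat_def)
  ultimately show ?thesis
    using card_negation_preimage[of p "\<lambda>z. lsb k z = s"] prime_gt_0_nat[OF p]
    by (simp add: card_monic_deg_le2_filter card_cartesian_product extractor_one[OF p])
qed

lemma pmf_extractor_deviation:
  assumes "s \<in> bitstrings k"
  shows "\<bar>pmf (map_pmf (extractor p k) (pmf_of_set (monic_deg_le2 p))) s - 1 / 2 ^ k\<bar>
    \<le> (real p + 2) / ((real p)\<^sup>2 + real p + 1)"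
proof -
  define c where "c = real (card {z \<in> {0..<int p}. lsb k z = s})"
  define e :: real where "e = of_bool (replicate k False = s)"
  define N where "N = (real p)\<^sup>2 + real p + 1"
  have N: "N > 0" by (simp add: N_def add_nonneg_pos)
  have "pmf (map_pmf (extractor p k) (pmf_of_set (monic_deg_le2 p))) s
      = card {u \<in> monic_deg_le2 p. extractor p k u = s} / card (monic_deg_le2 p)"
    by (simp add: pmf_map measure_pmf_of_set finite_monic_deg_le2[OF p]
        monic_deg_le2_nonempty[OF p] vimage_def Int_def)
  also have "\<dots> = ((real p + 1) * c + e) / N"
    by (simp add: card_extractor_fibre card_monic_deg_le2 c_def e_def N_def algebra_simps)
  \<comment> \<open>Since \<open>N = (p + 1) * p + 1\<close>, the uniform share
    \<open>N / 2 ^ k\<close> splits along the two terms of the count, so each is compared with its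
    own expected value.\<close>
  also have "(real p + 1) * c + e
      = ((real p + 1) * (c - p / 2 ^ k) + (e - 1 / 2 ^ k)) + N / 2 ^ k"
    by (simp add: N_def power2_eq_square algebra_simps add_divide_distrib)
  finally have "pmf (map_pmf (extractor p k) (pmf_of_set (monic_deg_le2 p))) s - 1 / 2 ^ k
      = ((real p + 1) * (c - p / 2 ^ k) + (e - 1 / 2 ^ k)) / N"
    using N by (simp add: add_divide_distrib)
  moreover have "\<bar>(real p + 1) * (c - p / 2 ^ k) + (e - 1 / 2 ^ k)\<bar> \<le> real p + 2"
  proof -
    have c: "\<bar>(real p + 1) * (c - p / 2 ^ k)\<bar> \<le> (real p + 1) * 1"
      unfolding abs_mult using card_lsb_fibre_bound[OF assms, of p]
      by (intro mult_mono) (auto simp: c_def)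
    have "0 \<le> 1 / (2::real) ^ k" "1 / (2::real) ^ k \<le> 1" "0 \<le> e" "e \<le> 1"
      by (simp_all add: e_def)
    \<comment> \<open>Both \<open>e\<close> and \<open>1 / 2 ^ k\<close> lie in
      \<open>[0, 1]\<close>, so the constant polynomial costs at most \<open>1\<close>.\<close>
    then have e: "\<bar>e - 1 / 2 ^ k\<bar> \<le> 1" by linarith
    show ?thesis
      using c e abs_triangle_ineq[of "(real p + 1) * (c - p / 2 ^ k)" "e - 1 / 2 ^ k"] by simp
  qed
  ultimately show ?thesis
    using N by (simp add: abs_divide divide_right_mono flip: N_def)
qed

lemma stat_dist_extractor_le:
  "stat_dist (bitstrings k) (map_pmf (extractor p k) (pmf_of_set (monic_deg_le2 p)))
    (pmf_of_set (bitstrings k)) \<le> 2 ^ k / real p"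
proof -
  let ?A = "map_pmf (extractor p k) (pmf_of_set (monic_deg_le2 p))"
  have "(\<Sum>s\<in>bitstrings k. \<bar>pmf ?A s - pmf (pmf_of_set (bitstrings k)) s\<bar>)
      \<le> (\<Sum>s\<in>bitstrings k. (real p + 2) / ((real p)\<^sup>2 + real p + 1))"
    using pmf_extractor_deviation
    by (intro sum_mono) (simp add: pmf_of_set finite_bitstrings bitstrings_nonempty card_bitstrings)
  also have "\<dots> = 2 ^ k * ((real p + 2) / ((real p)\<^sup>2 + real p + 1))"
    by (simp add: card_bitstrings)
  \<comment> \<open>After clearing denominators this is
    \<open>p^2 + 2 * p \<le> 2 * (p^2 + p + 1)\<close>. The factor \<open>2\<close> cancels the
    \<open>1 / 2\<close> in \<open>stat_dist\<close>.\<close>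
  also have "\<dots> \<le> 2 ^ k * (2 / real p)"
  proof (rule mult_left_mono)
    have "0 < (real p)\<^sup>2 + real p + 1" by (simp add: add_nonneg_pos)
    then show "(real p + 2) / ((real p)\<^sup>2 + real p + 1) \<le> 2 / real p"
      using prime_gt_0_nat[OF p] by (simp add: divide_simps) (simp add: algebra_simps power2_eq_square)
  qed simp
  finally show ?thesis by (simp add: stat_dist_def)
qed

end

theorem lemma20:
  shows "\<exists>C::real. C > 0 \<and>
    (\<forall>(p::nat) (k::nat). prime p \<longrightarrow> p \<ge> 3 \<longrightarrow> k \<ge> 1 \<longrightarrow>
      stat_dist (bitstrings k)
        (map_pmf (extractor p k) (pmf_of_set (monic_deg_le2 p)))
        (pmf_of_set (bitstrings k))
      \<le> C * (sqrt (2 ^ k / real p) * (1 + sqrt (log 2 (real p)) / (real p + 1))))"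
\<comment> \<open>The constant \<open>1\<close> works for all \<open>p\<close> and
  \<open>k\<close>.\<close>
proof (intro exI[of _ 1] conjI allI impI)
  fix p k :: nat
  assume p: "prime p" "p \<ge> 3"
  let ?x = "2 ^ k / real p"
  let ?d = "stat_dist (bitstrings k) (map_pmf (extractor p k) (pmf_of_set (monic_deg_le2 p)))
    (pmf_of_set (bitstrings k))"
  have "?d \<le> min 1 ?x"
    using stat_dist_le_1[OF finite_bitstrings] stat_dist_extractor_le[OF p(1)] by simp
  \<comment> \<open>For \<open>x \<ge> 0\<close>, \<open>min 1 x \<le> sqrt x\<close>: if
    \<open>x \<le> 1\<close> then \<open>x^2 \<le> x\<close>, otherwise
    \<open>1 \<le> sqrt x\<close>.\<close>
  also have "\<dots> \<le> sqrt ?x"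
  proof (cases "?x \<le> 1")
    case True
    then have "?x\<^sup>2 \<le> ?x" unfolding power2_eq_square by (rule mult_left_le) simp
    then have "?x \<le> sqrt ?x" by (rule real_le_rsqrt)
    then show ?thesis by linarith
  next
    case False
    then have "1 \<le> sqrt ?x" by (intro real_le_rsqrt) simp
    then show ?thesis by linarith
  qed
  \<comment> \<open>The last factor is at least \<open>1\<close>, as
    \<open>log 2 p \<ge> 0\<close>.\<close>
  also have "\<dots> \<le> sqrt ?x * (1 + sqrt (log 2 (real p)) / (real p + 1))"
    using p mult_left_mono[of 1 "1 + sqrt (log 2 (real p)) / (real p + 1)" "sqrt ?x"] by simp
  finally show "?d \<le> 1 * (sqrt ?x * (1 + sqrt (log 2 (real p)) / (real p + 1)))" by simp
qed simp

end
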